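(* Let $G$ be a graph on vertex set $[n]=\{1,\dots,n\}$ with maximum degree $\Delta$ and clique number $\omega$. There exists a constant $C>0$ (depending only on $\Delta$ and $\omega$) such that the following holds. If $\mathcal{H}\subseteq\binom{[n]}{k}$ is a $G$-intersecting $k$-uniform hypergraph and $k < C n^{1/2}$, then \[ |\mathcal{H}| \le \binom{n}{k}-\binom{n-\omega}{k}+\binom{\omega(\Delta-\omega+1)}{2}\binom{n-\omega-2}{k-2}. \] Furthermore, if $\mathcal{H}$ is a $G$-intersecting $k$-uniform hypergraph on $[n]$ of maximum cardinality (with $k<Cn^{1/2}$), then there exists a maximum clique $K$ in $G$ such that $\mathcal{H}$ contains every $k$-subset of $[n]$ that intersects $K$.
   Context: Let $G$ be a graph on $[n]$ and $\mathcal{H}$ a hypergraph on $[n]$. $\mathcal{H}$ is called $G$-intersecting if for every pair of edges $e,f\in\mathcal{H}$ we have $e\cap f\neq\emptyset$, or there exist vertices $v\in e$, $w\in f$ such that $v$ and $w$ are adjacent in $G$. A hypergraph is $k$-uniform if all its edges are $k$-subsets of the vertex set. A maximum clique is a clique of size equal to the clique number $\omega$. *)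

theory Defs
  imports Complex_Main "HOL-Library.Ramsey"
begin

text \<open>
  A simple graph on a vertex set \<open>V\<close> is given by its edge set \<open>G \<subseteq> nsets V 2\<close>, and a
  \<open>k\<close>-uniform hypergraph on \<open>V\<close> by its edge set \<open>H \<subseteq> nsets V k\<close>.
\<close>

definition vertex_degree :: "'a set set \<Rightarrow> 'a \<Rightarrow> nat" where
  "vertex_degree G v = card {w. {v, w} \<in> G}"

definition max_degree :: "'a set \<Rightarrow> 'a set set \<Rightarrow> nat" where
  "max_degree V G = Max (vertex_degree G ` V)"

definition clique_number :: "'a set \<Rightarrow> 'a set set \<Rightarrow> nat" where
  "clique_number V G = Max {card K | K. K \<subseteq> V \<and> clique K G}"

definition maximum_clique :: "'a set \<Rightarrow> 'a set set \<Rightarrow> 'a set \<Rightarrow> bool" where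
  "maximum_clique V G K \<longleftrightarrow> K \<subseteq> V \<and> clique K G \<and> card K = clique_number V G"

text \<open>
  The pair \<open>e = f\<close> is included: this matters only for the empty edge, which does not meet itself.
\<close>

definition graph_intersecting :: "'a set set \<Rightarrow> 'a set set \<Rightarrow> bool" where
  "graph_intersecting G H \<longleftrightarrow>
     (\<forall>e\<in>H. \<forall>f\<in>H. e \<inter> f \<noteq> {} \<or> (\<exists>v\<in>e. \<exists>w\<in>f. {v, w} \<in> G))"

definition max_graph_intersecting :: "'a set \<Rightarrow> 'a set set \<Rightarrow> nat \<Rightarrow> 'a set set \<Rightarrow> bool" where
  "max_graph_intersecting V G k H \<longleftrightarrow>
     H \<subseteq> nsets V k \<and> graph_intersecting G H \<and>
     (\<forall>H'. H' \<subseteq> nsets V k \<and> graph_intersecting G H' \<longrightarrow> card H' \<le> card H)"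

text \<open>
  Binomial coefficients with integer arguments, zero outside the range \<open>0 \<le> b \<le> a\<close>. Truncated
  subtraction would wrongly turn a lower index \<open>k - 2\<close> with \<open>k = 1\<close> into \<open>0\<close>.
\<close>

definition int_binomial :: "int \<Rightarrow> int \<Rightarrow> int" where
  "int_binomial a b = (if 0 \<le> b \<and> b \<le> a then int (nat a choose nat b) else 0)"

end

theory Submission
  imports Defs
begin

text \<open>
  Let \<open>H\<close> be a \<open>G\<close>-intersecting family of \<open>k\<close>-sets of maximum
  cardinality, and call \<open>S\<close> a cover if its closed neighbourhood meets every edge of
  \<open>H\<close>. By maximality every \<open>k\<close>-set containing a cover belongs to \<open>H\<close>,
  so any two covers of size at most \<open>k\<close> touch; in particular the one-vertex covers form a clique
  \<open>L\<close>.

  If \<open>m\<close> is the least size of a cover, every edge meets the at most \<open>m (\<Delta> +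
  1)\<close> vertices near such a cover, and a set that is not a cover extends in at most \<open>k (\<Delta> +
  1)\<close> ways towards an edge. So for \<open>L = {}\<close>, that is \<open>m \<ge> 2\<close>, there are
  at most \<open>m (\<Delta> + 1) (k (\<Delta> + 1))\<^bsup>m-1\<^esup>\<close> times \<open>n - m\<close>
  choose \<open>k - m\<close> edges, and for \<open>L \<noteq> {}\<close> there are at most \<open>k (\<Delta>
  + 1)\<^sup>2\<close> times \<open>n - 2\<close> choose \<open>k - 2\<close> edges missing \<open>L\<close>.
  Both are a small multiple of \<open>n - 1\<close> choose \<open>k - 1\<close> once \<open>k\<^sup>2 /
  n\<close> is small; the gain over naive branching is that the first factor is \<open>m\<close> rather than
  \<open>k\<close>. Comparing with the family of all \<open>k\<close>-sets meeting a maximum clique gives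
  \<open>|L| = \<omega>\<close>. Finally, an edge missing \<open>L\<close> has a neighbour of each vertex of
  \<open>L\<close>, and no vertex is adjacent to all of \<open>L\<close>, so it contains two of the at most
  \<open>\<omega> (\<Delta> - \<omega> + 1)\<close> outer neighbours of \<open>L\<close>.
\<close>

section \<open>Counting uniform sets and comparing binomial coefficients\<close>

lemma card_nsets_superset:
  assumes "finite V" "S \<subseteq> V" "card S \<le> k"
  shows "card {f \<in> nsets V k. S \<subseteq> f} = (card V - card S) choose (k - card S)"
proof -
  have fS: "finite S" using assms finite_subset by blast
  have "bij_betw (\<lambda>f. f - S) {f \<in> nsets V k. S \<subseteq> f} (nsets (V - S) (k - card S))"
  proof (rule bij_betw_byWitness[where f' = "\<lambda>g. g \<union> S"])
    show "(\<lambda>f. f - S) ` {f \<in> nsets V k. S \<subseteq> f} \<subseteq> nsets (V - S) (k - card S)"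
      using fS by (auto simp: nsets_def card_Diff_subset)
    show "(\<lambda>g. g \<union> S) ` nsets (V - S) (k - card S) \<subseteq> {f \<in> nsets V k. S \<subseteq> f}"
    proof (clarsimp simp: nsets_def fS, intro conjI)
      fix g assume g: "g \<subseteq> V - S" "finite g" "card g = k - card S"
      then show "g \<subseteq> V" "S \<subseteq> V" using assms by auto
      have "card (g \<union> S) = card g + card S"
        using g fS by (intro card_Un_disjoint) auto
      then show "card (g \<union> S) = k" using g assms by simp
    qed
  qed (auto simp: nsets_def)
  then show ?thesis
    using assms fS by (simp add: bij_betw_same_card card_Diff_subset)
qed

lemma card_nsets_meeting:
  assumes "finite V" "L \<subseteq> V"
  shows "card {f \<in> nsets V k. f \<inter> L \<noteq> {}} = (card V choose k) - ((card V - card L) choose k)"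
proof -
  have eq: "{f \<in> nsets V k. f \<inter> L \<noteq> {}} = nsets V k - nsets (V - L) k"
    by (auto simp: nsets_def)
  have "nsets (V - L) k \<subseteq> nsets V k"
    by (auto simp: nsets_def)
  then show ?thesis
    using assms finite_subset[OF assms(2,1)] unfolding eq
    by (simp add: card_Diff_subset finite_imp_finite_nsets)
qed

text \<open>Lowering both indices by one divides the coefficient by \<open>N / K\<close>, which is
  at least \<open>q\<close>. The hypothesis survives each step, since \<open>q * K \<le> N\<close>
  and \<open>1 \<le> q\<close> give \<open>q * (K - 1) \<le> N - 1\<close>.\<close>

lemma choose_shift_le:
  fixes q :: nat
  assumes "q * K \<le> N" "1 \<le> q" "j \<le> K"
  shows "q ^ j * ((N - j) choose (K - j)) \<le> N choose K"
  using assms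
proof (induction j arbitrary: N K)
  case 0
  then show ?case by simp
next
  case (Suc j)
  obtain K' where K: "K = Suc K'" using Suc.prems by (cases K) auto
  obtain N' where N: "N = Suc N'" using Suc.prems K by (cases N) auto
  have "q ^ j * ((N' - j) choose (K' - j)) \<le> N' choose K'"
    using Suc.prems K N by (intro Suc.IH) auto
  then have 1: "q ^ Suc j * ((N' - j) choose (K' - j)) \<le> q * (N' choose K')"
    by simp
  have "K * (q * (N' choose K')) \<le> N * (N' choose K')"
    using mult_right_mono[OF Suc.prems(1), of "N' choose K'"] by (simp add: mult_ac)
  also have "\<dots> = K * (N choose K)"
    using Suc_times_binomial[of K' N'] unfolding K N by simp
  finally have "q * (N' choose K') \<le> N choose K"
    unfolding K by (simp only: mult_le_cancel1)
  with 1 have "q ^ Suc j * ((N' - j) choose (K' - j)) \<le> N choose K" by (rule le_trans)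
  then show ?case by (simp only: K N diff_Suc_Suc)
qed

text \<open>Pascal's rule applied \<open>l\<close> times; each application loses at most
  \<open>N choose K\<close>.\<close>

lemma choose_le_choose_diff_add:
  "(Suc N choose Suc K) \<le> ((Suc N - l) choose Suc K) + l * (N choose K)"
proof (induction l)
  case 0
  then show ?case by simp
next
  case (Suc l)
  have "((Suc N - l) choose Suc K) \<le> ((Suc N - Suc l) choose Suc K) + (N choose K)"
  proof (cases "l \<le> N")
    case True
    then have "Suc N - l = Suc (N - l)" by simp
    moreover have "(N - l) choose K \<le> N choose K"
      by (intro binomial_right_mono) simp
    ultimately show ?thesis by simp
  qed simp
  with Suc show ?case by simp
qed

text \<open>Measures the gain of a larger clique: of the \<open>k\<close>-sets avoiding
  \<open>l\<close> vertices, those through one further vertex already number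
  \<open>(n - l - 1) choose (k - 1)\<close>.\<close>

lemma choose_diff_add_le:
  assumes "l < w" "w \<le> n" "1 \<le> k"
  shows "((n - w) choose k) + ((n - l - 1) choose (k - 1)) \<le> ((n - l) choose k)"
proof -
  have "Suc (n - l - 1) = n - l" "Suc (k - 1) = k" using assms by auto
  then have "((n - l) choose k) = ((n - l - 1) choose (k - 1)) + ((n - l - 1) choose k)"
    using binomial_Suc_Suc[of "n - l - 1" "k - 1"] by simp
  moreover have "(n - w) choose k \<le> (n - l - 1) choose k"
    using assms by (intro binomial_right_mono) auto
  ultimately show ?thesis by simp
qed

lemma Suc_le_two_power: "Suc j \<le> 2 ^ j"
  by (induction j) auto

lemma int_binomial_of_nat: "int_binomial (int a) (int b) = int (a choose b)"
  by (auto simp: int_binomial_def)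

section \<open>Closed neighbourhoods and covers\<close>

definition closed_nbhd :: "'a set set \<Rightarrow> 'a set \<Rightarrow> 'a set" where
  "closed_nbhd G S = S \<union> {w. \<exists>v\<in>S. {v, w} \<in> G}"

text \<open>Chosen so that being \<open>G\<close>-intersecting says that every edge is itself a
  cover; smaller covers can then be sought below the edges.\<close>

definition nbhd_cover :: "'a set set \<Rightarrow> 'a set set \<Rightarrow> 'a set \<Rightarrow> bool" where
  "nbhd_cover G H S \<longleftrightarrow> (\<forall>e\<in>H. closed_nbhd G S \<inter> e \<noteq> {})"

lemma closed_nbhd_disjoint_sym:
  "closed_nbhd G S \<inter> T = {} \<longleftrightarrow> closed_nbhd G T \<inter> S = {}"
proof -
  have "{v, w} \<in> G \<longleftrightarrow> {w, v} \<in> G" for v w by (simp add: insert_commute)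
  then show ?thesis unfolding closed_nbhd_def by blast
qed

lemma closed_nbhd_mono: "S \<subseteq> T \<Longrightarrow> closed_nbhd G S \<subseteq> closed_nbhd G T"
  unfolding closed_nbhd_def by auto

lemma nbhd_cover_mono: "nbhd_cover G H S \<Longrightarrow> S \<subseteq> T \<Longrightarrow> nbhd_cover G H T"
  unfolding nbhd_cover_def using closed_nbhd_mono[of S T G] by fast

lemma graph_intersecting_iff_cover:
  "graph_intersecting G H \<longleftrightarrow> (\<forall>e\<in>H. nbhd_cover G H e)"
proof -
  have "closed_nbhd G e \<inter> f \<noteq> {} \<longleftrightarrow> e \<inter> f \<noteq> {} \<or> (\<exists>v\<in>e. \<exists>w\<in>f. {v, w} \<in> G)" for e f
    unfolding closed_nbhd_def by auto
  then show ?thesis unfolding graph_intersecting_def nbhd_cover_def by simp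
qed

section \<open>Cliques and neighbourhoods under a degree bound\<close>

locale bounded_degree_graph =
  fixes V :: "'a set" and G :: "'a set set" and d :: nat
  assumes finite_V: "finite V"
    and edges: "G \<subseteq> nsets V 2"
    and degree_le: "v \<in> V \<Longrightarrow> vertex_degree G v \<le> d"
begin

lemma edgeD: "{v, w} \<in> G \<Longrightarrow> v \<in> V \<and> w \<in> V \<and> v \<noteq> w"
  using subsetD[OF edges, of "{v, w}"] by (auto simp: nsets_def card_insert_if split: if_splits)

lemma finite_neighbours: "finite {w. {v, w} \<in> G}"
  by (rule finite_subset[OF _ finite_V]) (auto dest: edgeD)

lemma closed_nbhd_subset: "S \<subseteq> V \<Longrightarrow> closed_nbhd G S \<subseteq> V"
  unfolding closed_nbhd_def by (auto dest: edgeD)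

lemma card_closed_nbhd_le:
  assumes "S \<subseteq> V"
  shows "card (closed_nbhd G S) \<le> card S * (d + 1)"
proof -
  have fS: "finite S" using assms finite_V finite_subset by blast
  have eq: "closed_nbhd G S = (\<Union>v\<in>S. insert v {w. {v, w} \<in> G})"
    unfolding closed_nbhd_def by auto
  have "card (closed_nbhd G S) \<le> (\<Sum>v\<in>S. card (insert v {w. {v, w} \<in> G}))"
    unfolding eq by (rule card_UN_le[OF fS])
  also have "\<dots> \<le> (\<Sum>v\<in>S. d + 1)"
  proof (rule sum_mono)
    fix v assume "v \<in> S"
    then have "card {w. {v, w} \<in> G} \<le> d"
      using degree_le[of v] assms unfolding vertex_degree_def by auto
    then show "card (insert v {w. {v, w} \<in> G}) \<le> d + 1"
      using finite_neighbours by (simp add: card_insert_if)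
  qed
  finally show ?thesis by simp
qed

lemma card_clique_le:
  assumes "K \<subseteq> V" "clique K G"
  shows "card K \<le> d + 1"
proof (cases "K = {}")
  case False
  then obtain v where v: "v \<in> K" by blast
  have "K \<subseteq> closed_nbhd G {v}"
    using assms v unfolding clique_def closed_nbhd_def by auto
  moreover have "finite (closed_nbhd G {v})"
    using closed_nbhd_subset[of "{v}"] v assms finite_V finite_subset by blast
  ultimately have "card K \<le> card (closed_nbhd G {v})" by (rule card_mono[rotated])
  also have "\<dots> \<le> d + 1" using card_closed_nbhd_le[of "{v}"] v assms by auto
  finally show ?thesis .
qed simp

lemma finite_clique_cards: "finite {card K | K. K \<subseteq> V \<and> clique K G}"
  using finite_V by simp

lemma card_clique_le_clique_number:
  assumes "K \<subseteq> V" "clique K G"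
  shows "card K \<le> clique_number V G"
  unfolding clique_number_def using finite_clique_cards assms by (intro Max_ge) auto

lemma maximum_clique_exists: "\<exists>K. maximum_clique V G K"
proof -
  \<comment> \<open>The empty clique makes the set under \<open>Max\<close> nonempty, even when
    \<open>V\<close> is empty.\<close>
  have "card {} \<in> {card K | K. K \<subseteq> V \<and> clique K G}"
    by (intro CollectI exI[of _ "{}"]) (auto simp: clique_def)
  then have "clique_number V G \<in> {card K | K. K \<subseteq> V \<and> clique K G}"
    unfolding clique_number_def using finite_clique_cards by (intro Max_in) auto
  then show ?thesis unfolding maximum_clique_def by auto
qed

lemma clique_number_bounds: "clique_number V G \<le> d + 1" "clique_number V G \<le> card V"
proof -
  obtain K where "K \<subseteq> V" "clique K G" "card K = clique_number V G"
    using maximum_clique_exists unfolding maximum_clique_def by blast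
  then show "clique_number V G \<le> d + 1" "clique_number V G \<le> card V"
    using card_clique_le[of K] card_mono[OF finite_V, of K] by auto
qed

lemma clique_number_pos:
  assumes "V \<noteq> {}"
  shows "1 \<le> clique_number V G"
proof -
  obtain v where "v \<in> V" using assms by blast
  then show ?thesis
    using card_clique_le_clique_number[of "{v}"] by (simp add: clique_def)
qed

lemma max_graph_intersecting_exists: "\<exists>H. max_graph_intersecting V G k H"
proof -
  define F where "F = {H. H \<subseteq> nsets V k \<and> graph_intersecting G H}"
  have "finite F"
    by (rule finite_subset[of _ "Pow (nsets V k)"])
      (auto simp: F_def finite_imp_finite_nsets finite_V)
  moreover have "{} \<in> F" by (simp add: F_def graph_intersecting_def)
  ultimately have "Max (card ` F) \<in> card ` F" and le: "\<And>H. H \<in> F \<Longrightarrow> card H \<le> Max (card ` F)"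
    by (auto intro!: Max_in)
  then obtain H where "H \<in> F" "card H = Max (card ` F)" by auto
  with le show ?thesis unfolding max_graph_intersecting_def F_def by auto
qed

end

section \<open>Covers of a family of maximum cardinality\<close>

locale max_family = bounded_degree_graph +
  fixes k :: nat and H :: "'a set set"
  assumes max_H: "max_graph_intersecting V G k H"
    and k_pos: "1 \<le> k"
    and k_small: "4 * (d + 1)\<^sup>2 * k * k < card V"
begin

lemma edges_H: "H \<subseteq> nsets V k" and intersecting_H: "graph_intersecting G H"
  and H_maximum: "H' \<subseteq> nsets V k \<Longrightarrow> graph_intersecting G H' \<Longrightarrow> card H' \<le> card H"
  using max_H unfolding max_graph_intersecting_def by auto

lemma finite_H: "finite H"
  using edges_H finite_imp_finite_nsets[OF finite_V] finite_subset by blast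

lemma H_D: "e \<in> H \<Longrightarrow> e \<subseteq> V \<and> finite e \<and> card e = k"
  using edges_H by (auto simp: nsets_def)

text \<open>Adding \<open>e\<close> keeps the family \<open>G\<close>-intersecting, because a
  superset of a cover is a cover; maximality then leaves no room for a new edge.\<close>

lemma cover_in_H:
  assumes "nbhd_cover G H S" "S \<subseteq> e" "e \<in> nsets V k"
  shows "e \<in> H"
proof -
  have ce: "nbhd_cover G H e" using assms nbhd_cover_mono by blast
  \<comment> \<open>The enlarged family must also satisfy the condition for the pair
    \<open>e\<close>, \<open>e\<close>, which an empty edge would violate.\<close>
  have "e \<noteq> {}" using assms(3) k_pos by (auto simp: nsets_def)
  then have "closed_nbhd G e \<inter> e \<noteq> {}" by (auto simp: closed_nbhd_def)
  then have "graph_intersecting G (insert e H)"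
    using ce intersecting_H closed_nbhd_disjoint_sym
    unfolding graph_intersecting_iff_cover nbhd_cover_def by (metis insert_iff)
  then have "card (insert e H) \<le> card H"
    using H_maximum assms(3) edges_H by auto
  then show ?thesis using finite_H by (auto simp: card_insert_if split: if_splits)
qed

text \<open>The neighbourhood of \<open>S\<close> has at most \<open>k * (d + 1)\<close> vertices,
  and \<open>k_small\<close> leaves at least \<open>k\<close> vertices outside it to complete
  \<open>T\<close>.\<close>

lemma extend_avoiding:
  assumes "S \<subseteq> V" "card S \<le> k" "T \<subseteq> V" "card T \<le> k" "closed_nbhd G S \<inter> T = {}"
  obtains e where "e \<in> nsets V k" "T \<subseteq> e" "closed_nbhd G S \<inter> e = {}"
proof -
  have "card (closed_nbhd G S) \<le> k * (d + 1)"
    using card_closed_nbhd_le[OF assms(1)] assms(2) by (meson le_trans mult_le_mono1)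
  moreover have "k * (d + 1) + k \<le> card V"
  proof -
    have "d + 2 \<le> 4 * (d + 1)\<^sup>2 * k"
    proof -
      have "d + 2 \<le> 4 * (d + 1)\<^sup>2" by (simp add: power2_eq_square)
      also have "\<dots> \<le> 4 * (d + 1)\<^sup>2 * k" using k_pos by simp
      finally show ?thesis .
    qed
    then have "(d + 2) * k \<le> 4 * (d + 1)\<^sup>2 * k * k" by (rule mult_le_mono1)
    then show ?thesis using k_small by (simp add: algebra_simps)
  qed
  moreover have "card (V - closed_nbhd G S) = card V - card (closed_nbhd G S)"
    using closed_nbhd_subset[OF assms(1)] finite_V finite_subset by (metis card_Diff_subset)
  ultimately have "k \<le> card (V - closed_nbhd G S)" by linarith
  moreover have "T \<subseteq> V - closed_nbhd G S" using assms by auto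
  ultimately obtain e where "T \<subseteq> e" "e \<subseteq> V - closed_nbhd G S" "card e = k"
    using exists_subset_between[of T k] assms finite_V by blast
  then show ?thesis
    using finite_V by (intro that[of e]) (auto simp: nsets_def intro: finite_subset)
qed

text \<open>Two covers that do not touch could be extended to two non-touching \<open>k\<close>-sets, both of which
  belong to \<open>H\<close> by maximality.\<close>

lemma covers_touch:
  assumes "S \<subseteq> V" "card S \<le> k" "nbhd_cover G H S" "T \<subseteq> V" "card T \<le> k" "nbhd_cover G H T"
  shows "closed_nbhd G S \<inter> T \<noteq> {}"
proof
  assume "closed_nbhd G S \<inter> T = {}"
  then obtain e where e: "e \<in> nsets V k" "T \<subseteq> e" "closed_nbhd G S \<inter> e = {}"
    using extend_avoiding assms by metis
  then have "closed_nbhd G e \<inter> S = {}" using closed_nbhd_disjoint_sym by metis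
  moreover have "e \<subseteq> V" "card e \<le> k" using e by (auto simp: nsets_def)
  ultimately obtain f where f: "f \<in> nsets V k" "S \<subseteq> f" "closed_nbhd G e \<inter> f = {}"
    using extend_avoiding assms by metis
  have "e \<in> H" "f \<in> H" using cover_in_H e f assms by blast+
  with f(3) show False
    using intersecting_H unfolding graph_intersecting_iff_cover nbhd_cover_def by blast
qed

text \<open>The set \<open>L\<close> of the overview, to be identified as a maximum clique.\<close>

definition core :: "'a set" where
  "core = {v \<in> V. nbhd_cover G H {v}}"

lemma core_clique: "clique core G"
  unfolding clique_def
proof (intro ballI impI)
  fix v w assume "v \<in> core" "w \<in> core" "v \<noteq> w"
  then show "{v, w} \<in> G"
    using covers_touch[of "{v}" "{w}"] k_pos by (auto simp: core_def closed_nbhd_def)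
qed

lemma core_subset: "core \<subseteq> V"
  by (auto simp: core_def)

section \<open>Branching bounds on the number of edges through a set\<close>

lemma card_le_branching:
  assumes "finite A" "\<And>f. f \<in> H \<Longrightarrow> A \<inter> f \<noteq> {}" "F \<subseteq> H" "card A \<le> a"
    and "\<And>u. u \<in> A \<Longrightarrow> card {f \<in> F. u \<in> f} \<le> b"
  shows "card F \<le> a * b"
proof -
  have "F \<subseteq> (\<Union>u\<in>A. {f \<in> F. u \<in> f})" using assms by blast
  then have "card F \<le> card (\<Union>u\<in>A. {f \<in> F. u \<in> f})"
    using finite_subset[OF assms(3) finite_H] assms(1) by (intro card_mono) auto
  also have "\<dots> \<le> (\<Sum>u\<in>A. card {f \<in> F. u \<in> f})" by (rule card_UN_le[OF assms(1)])
  also have "\<dots> \<le> card A * b" using assms(5) sum_bounded_above[of A _ b] by simp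
  also have "\<dots> \<le> a * b" using assms(4) by simp
  finally show ?thesis .
qed

lemma degree_le_choose:
  assumes "S \<subseteq> V" "card S \<le> k"
  shows "card {f \<in> H. S \<subseteq> f} \<le> (card V - card S) choose (k - card S)"
proof -
  have "card {f \<in> H. S \<subseteq> f} \<le> card {f \<in> nsets V k. S \<subseteq> f}"
    using edges_H finite_imp_finite_nsets[OF finite_V] by (intro card_mono) auto
  then show ?thesis using card_nsets_superset[OF finite_V assms] by simp
qed

text \<open>A set that is not a cover misses the closed neighbourhood of some edge, and every edge
  containing it must contain one of the at most \<open>k (d + 1)\<close> vertices of that neighbourhood.\<close>

lemma degree_le_power:
  assumes "S \<subseteq> V" "card S + j \<le> k"
    and "\<And>T. S \<subseteq> T \<Longrightarrow> T \<subseteq> V \<Longrightarrow> card T < card S + j \<Longrightarrow> \<not> nbhd_cover G H T"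
  shows "card {f \<in> H. S \<subseteq> f}
    \<le> (k * (d + 1)) ^ j * ((card V - (card S + j)) choose (k - (card S + j)))"
  using assms
proof (induction j arbitrary: S)
  case 0
  then show ?case using degree_le_choose by simp
next
  case (Suc j)
  have fS: "finite S" using Suc.prems finite_V finite_subset by blast
  have "\<not> nbhd_cover G H S" using Suc.prems by simp
  then obtain e where e: "e \<in> H" "closed_nbhd G S \<inter> e = {}"
    unfolding nbhd_cover_def by blast
  then have eS: "closed_nbhd G e \<inter> S = {}" using closed_nbhd_disjoint_sym by metis
  let ?b = "(k * (d + 1)) ^ j * ((card V - (card S + Suc j)) choose (k - (card S + Suc j)))"
  have sub: "closed_nbhd G e \<subseteq> V" using e H_D closed_nbhd_subset by blast
  have "card {f \<in> H. S \<subseteq> f} \<le> (k * (d + 1)) * ?b"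
  proof (rule card_le_branching)
    show "finite (closed_nbhd G e)" using sub finite_V finite_subset by blast
    show "card (closed_nbhd G e) \<le> k * (d + 1)"
      using card_closed_nbhd_le[of e] H_D[OF e(1)] by simp
    show "closed_nbhd G e \<inter> f \<noteq> {}" if "f \<in> H" for f
      using that e(1) intersecting_H unfolding graph_intersecting_iff_cover nbhd_cover_def by blast
    fix u assume u: "u \<in> closed_nbhd G e"
    \<comment> \<open>The neighbourhood of \<open>e\<close> misses \<open>S\<close>, so
      \<open>u\<close> is new and each branching adds exactly one vertex.\<close>
    then have cu: "card (insert u S) = Suc (card S)" using eS fS by (auto simp: card_insert_if)
    have "card {f \<in> H. insert u S \<subseteq> f} \<le> (k * (d + 1)) ^ j *
      ((card V - (card (insert u S) + j)) choose (k - (card (insert u S) + j)))"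
      using Suc.prems u sub by (intro Suc.IH) (auto simp: cu)
    moreover have "{f \<in> {f \<in> H. S \<subseteq> f}. u \<in> f} = {f \<in> H. insert u S \<subseteq> f}" by auto
    ultimately show "card {f \<in> {f \<in> H. S \<subseteq> f}. u \<in> f} \<le> ?b" by (simp add: cu)
  qed auto
  then show ?case by (simp add: mult_ac)
qed

section \<open>Comparison with the sets meeting a maximum clique\<close>

lemma card_H_ge: "(card V choose k) - ((card V - clique_number V G) choose k) \<le> card H"
proof -
  obtain K where K: "K \<subseteq> V" "clique K G" "card K = clique_number V G"
    using maximum_clique_exists unfolding maximum_clique_def by blast
  have "graph_intersecting G {f \<in> nsets V k. f \<inter> K \<noteq> {}}"
    unfolding graph_intersecting_def
  proof (intro ballI)
    fix e f assume "e \<in> {f \<in> nsets V k. f \<inter> K \<noteq> {}}" "f \<in> {f \<in> nsets V k. f \<inter> K \<noteq> {}}"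
    then obtain v w where "v \<in> e" "v \<in> K" "w \<in> f" "w \<in> K" by blast
    then show "e \<inter> f \<noteq> {} \<or> (\<exists>v\<in>e. \<exists>w\<in>f. {v, w} \<in> G)"
      using K(2) unfolding clique_def by (cases "v = w") blast+
  qed
  then have "card {f \<in> nsets V k. f \<inter> K \<noteq> {}} \<le> card H"
    by (intro H_maximum) auto
  then show ?thesis using card_nsets_meeting[OF finite_V K(1)] K(3) by simp
qed

lemma card_V_pos: "0 < card V"
  using k_small by linarith

text \<open>Used with \<open>l = card core\<close>: if the core is too small, at least the last
  summand must come from edges missing it.\<close>

lemma card_H_ge_add:
  assumes "l < clique_number V G"
  shows "(card V choose k) - ((card V - l) choose k) + ((card V - l - 1) choose (k - 1)) \<le> card H"
proof -
  have "((card V - l) choose k) \<le> card V choose k" by (intro binomial_right_mono) simp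
  then show ?thesis
    using card_H_ge choose_diff_add_le[OF assms clique_number_bounds(2) k_pos] by linarith
qed

lemma choose_shift_card:
  assumes "j \<le> k - 1"
  shows "(4 * (d + 1)\<^sup>2 * k) ^ j * ((card V - 1 - j) choose (k - 1 - j)) \<le> (card V - 1) choose (k - 1)"
proof (rule choose_shift_le[OF _ _ assms])
  show q: "1 \<le> 4 * (d + 1)\<^sup>2 * k" using k_pos by simp
  have "4 * (d + 1)\<^sup>2 * k * (k - 1) \<le> 4 * (d + 1)\<^sup>2 * k * k - 4 * (d + 1)\<^sup>2 * k"
    by (simp add: diff_mult_distrib2)
  then show "4 * (d + 1)\<^sup>2 * k * (k - 1) \<le> card V - 1" using k_small q by linarith
qed

lemma core_nonempty: "core \<noteq> {}"
proof
  assume empty: "core = {}"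
  have V: "V \<noteq> {}" using card_V_pos by auto
  have "1 \<le> (card V - 1) choose (k - 1)"
  proof -
    have "k * 1 \<le> 4 * (d + 1)\<^sup>2 * k * k" using k_pos by simp
    then have "k - 1 \<le> card V - 1" using k_small by linarith
    then show ?thesis by (simp add: Suc_le_eq)
  qed
  then have big: "(card V - 1) choose (k - 1) \<le> card H" "1 \<le> card H"
    using card_H_ge_add[of 0] clique_number_pos[OF V] by auto
  then obtain e where "e \<in> H" by (metis card.empty ex_in_conv not_one_le_zero)
  then have e: "e \<subseteq> V \<and> nbhd_cover G H e \<and> card e = k"
    using intersecting_H H_D unfolding graph_intersecting_iff_cover by blast
  \<comment> \<open>A cover of least size is sought; an edge is a cover of size \<open>k\<close>, so
    \<open>m \<le> k\<close>.\<close>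
  define P where "P m \<longleftrightarrow> (\<exists>S\<subseteq>V. nbhd_cover G H S \<and> card S = m)" for m
  define m where "m = (LEAST m. P m)"
  have Pk: "P k" using e by (auto simp: P_def)
  then have "P m" and mk: "m \<le> k" unfolding m_def by (auto intro: LeastI Least_le)
  then obtain S where S: "S \<subseteq> V" "nbhd_cover G H S" "card S = m" by (auto simp: P_def)
  have small: "\<not> nbhd_cover G H T" if "T \<subseteq> V" "card T < m" for T
    using that not_less_Least[of "card T" P] unfolding m_def P_def by blast
  have "m \<noteq> 0"
  proof
    assume "m = 0"
    then have "S = {}" using S finite_V finite_subset by (metis card_0_eq)
    then show False using S(2) \<open>e \<in> H\<close> by (auto simp: nbhd_cover_def closed_nbhd_def)
  qed
  moreover have "m \<noteq> 1"
  proof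
    assume "m = 1"
    then obtain v where "S = {v}" using S(3) card_1_singletonE by blast
    then have "v \<in> core" using S by (simp add: core_def)
    then show False using empty by simp
  qed
  ultimately obtain j where j: "m = Suc j" "1 \<le> j" by (cases m) auto
  let ?c = "(card V - 1 - j) choose (k - 1 - j)"
  \<comment> \<open>The first branching uses the minimal cover \<open>S\<close>, of size
    \<open>Suc j\<close>, instead of an edge. From a single vertex, \<open>j\<close> further
    branchings stay below the cover size \<open>m\<close>.\<close>
  have "card H \<le> (Suc j * (d + 1)) * ((k * (d + 1)) ^ j * ?c)"
  proof (rule card_le_branching[of "closed_nbhd G S"])
    show "finite (closed_nbhd G S)" using closed_nbhd_subset[OF S(1)] finite_V finite_subset by blast
    show "card (closed_nbhd G S) \<le> Suc j * (d + 1)" using card_closed_nbhd_le[OF S(1)] S(3) j by simp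
    show "closed_nbhd G S \<inter> f \<noteq> {}" if "f \<in> H" for f
      using S(2) that unfolding nbhd_cover_def by blast
    fix u assume "u \<in> closed_nbhd G S"
    then have "u \<in> V" using closed_nbhd_subset[OF S(1)] by blast
    then show "card {f \<in> H. u \<in> f} \<le> (k * (d + 1)) ^ j * ?c"
      using degree_le_power[of "{u}" j] small j mk by simp
  qed simp
  also have "\<dots> = (Suc j * (d + 1) ^ Suc j) * (k ^ j * ?c)"
    by (simp only: power_mult_distrib power_Suc mult_ac)
  also have "\<dots> < (4 * (d + 1)\<^sup>2) ^ j * (k ^ j * ?c)"
  proof (rule mult_strict_right_mono)
    \<comment> \<open>From \<open>1 \<le> j\<close> follows \<open>Suc j \<le> 2 * j\<close>, which
      bounds the exponent; passing from \<open>2 ^ j\<close> to \<open>4 ^ j\<close> makes the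
      comparison strict.\<close>
    have "Suc j * (d + 1) ^ Suc j \<le> 2 ^ j * (d + 1) ^ (2 * j)"
      using j by (intro mult_mono Suc_le_two_power power_increasing) auto
    also have "\<dots> < 4 ^ j * (d + 1) ^ (2 * j)"
      using j by (intro mult_strict_right_mono power_strict_mono) auto
    also have "\<dots> = (4 * (d + 1)\<^sup>2) ^ j" by (simp only: power_mult_distrib power_mult)
    finally show "Suc j * (d + 1) ^ Suc j < (4 * (d + 1)\<^sup>2) ^ j" .
    have "k \<le> card V" using e card_mono[OF finite_V] by metis
    then have "k - 1 - j \<le> card V - 1 - j" by simp
    then show "0 < k ^ j * ?c" using k_pos by simp
  qed
  also have "\<dots> \<le> (card V - 1) choose (k - 1)"
    using choose_shift_card[of j] j mk by (simp add: power_mult_distrib mult_ac)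
  finally show False using big by simp
qed

text \<open>A core smaller than the clique number would force about
  \<open>(card V - 1) choose (k - 1)\<close> edges to miss it. Two branchings, from a core vertex
  and then from a vertex outside the core, allow only a small fraction of that.\<close>

lemma core_maximum: "maximum_clique V G core"
proof -
  have "\<not> card core < clique_number V G"
  proof
    assume less: "card core < clique_number V G"
    let ?l = "card core"
    obtain v where v: "v \<in> core" using core_nonempty by blast
    define F where "F = {f \<in> H. f \<inter> core = {}}"
    have "H \<subseteq> {f \<in> nsets V k. f \<inter> core \<noteq> {}} \<union> F" using edges_H by (auto simp: F_def)
    then have "card H \<le> card ({f \<in> nsets V k. f \<inter> core \<noteq> {}} \<union> F)"
      using finite_H finite_imp_finite_nsets[OF finite_V] by (intro card_mono) (auto simp: F_def)
    also have "\<dots> \<le> card {f \<in> nsets V k. f \<inter> core \<noteq> {}} + card F" by (rule card_Un_le)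
    finally have "card H \<le> (card V choose k) - ((card V - ?l) choose k) + card F"
      using card_nsets_meeting[OF finite_V core_subset] by simp
    then have F_ge: "(card V - ?l - 1) choose (k - 1) \<le> card F"
      using card_H_ge_add[OF less] by linarith
    have kV: "k \<le> card V - ?l"
    proof -
      have "?l \<le> d" using less clique_number_bounds(1) by linarith
      moreover have "k + d \<le> 4 * (d + 1)\<^sup>2 * k * k"
      proof -
        have "k + d \<le> 4 * (d + 1)\<^sup>2 * k"
        proof -
          have "k + d \<le> k + d * k" using k_pos by simp
          also have "\<dots> = (d + 1) * k" by simp
          also have "\<dots> \<le> 4 * (d + 1)\<^sup>2 * k" by (intro mult_le_mono1) (simp add: power2_eq_square)
          finally show ?thesis .
        qed
        also have "\<dots> \<le> 4 * (d + 1)\<^sup>2 * k * k" using k_pos by simp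
        finally show ?thesis .
      qed
      ultimately show ?thesis using k_small by linarith
    qed
    have "0 < (card V - ?l - 1) choose (k - 1)" using kV by simp
    with F_ge have "F \<noteq> {}" by auto
    \<comment> \<open>For \<open>k = 1\<close> an edge is a one-vertex cover, hence lies in the core
      and cannot miss it.\<close>
    have k2: "2 \<le> k"
    proof (rule ccontr)
      assume "\<not> 2 \<le> k"
      then have k1: "k = 1" using k_pos by simp
      obtain f where f: "f \<in> F" using \<open>F \<noteq> {}\<close> by blast
      then have fH: "f \<in> H" "f \<inter> core = {}" by (auto simp: F_def)
      then obtain u where u: "f = {u}" using H_D k1 by (metis card_1_singletonE)
      have "nbhd_cover G H {u}"
        using fH u intersecting_H unfolding graph_intersecting_iff_cover by blast
      then show False using fH u H_D by (auto simp: core_def)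
    qed
    let ?c = "(card V - 2) choose (k - 2)"
    have "card F \<le> (d + 1) * (k * (d + 1) * ?c)"
    proof (rule card_le_branching[of "closed_nbhd G {v}"])
      have vV: "{v} \<subseteq> V" using v core_subset by blast
      show "finite (closed_nbhd G {v})" using closed_nbhd_subset[OF vV] finite_V finite_subset by blast
      show "card (closed_nbhd G {v}) \<le> d + 1" using card_closed_nbhd_le[OF vV] by simp
      show "closed_nbhd G {v} \<inter> f \<noteq> {}" if "f \<in> H" for f
        using v that unfolding core_def nbhd_cover_def by blast
      fix u assume "u \<in> closed_nbhd G {v}"
      then have uV: "u \<in> V" using closed_nbhd_subset[OF vV] by blast
      show "card {f \<in> F. u \<in> f} \<le> k * (d + 1) * ?c"
      proof (cases "u \<in> core")
        case True
        then have "{f \<in> F. u \<in> f} = {}" by (auto simp: F_def)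
        then show ?thesis by (metis card.empty le0)
      next
        case False
        have nc: "\<not> nbhd_cover G H T" if "{u} \<subseteq> T" "T \<subseteq> V" "card T < card {u} + 1" for T
        proof -
          have "finite T" using that finite_V finite_subset by blast
          then have "T = {u}" using that card_seteq[of T "{u}"] by simp
          then show ?thesis using False uV by (simp add: core_def)
        qed
        have "card {f \<in> H. {u} \<subseteq> f} \<le> (k * (d + 1)) ^ 1 *
            ((card V - (card {u} + 1)) choose (k - (card {u} + 1)))"
          using uV k2 by (intro degree_le_power nc) auto
        moreover have "card {f \<in> F. u \<in> f} \<le> card {f \<in> H. {u} \<subseteq> f}"
          using finite_H by (intro card_mono) (auto simp: F_def)
        ultimately show ?thesis by (simp add: numeral_2_eq_2)
      qed
    qed (auto simp: F_def)
    \<comment> \<open>Raising the upper index in the lower bound for \<open>F\<close> from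
      \<open>card V - ?l - 1\<close> to \<open>card V - 1\<close> costs only
      \<open>?l * ?c\<close>.\<close>
    moreover have "((card V - 1) choose (k - 1)) \<le> ((card V - ?l - 1) choose (k - 1)) + ?l * ?c"
      using choose_le_choose_diff_add[of "card V - 2" "k - 2" ?l] k2 kV
      by (simp add: numeral_2_eq_2 Suc_diff_Suc)
    moreover have "4 * (d + 1)\<^sup>2 * k * ?c \<le> (card V - 1) choose (k - 1)"
      using choose_shift_card[of 1] k2 by (simp add: numeral_2_eq_2)
    ultimately have "4 * (d + 1)\<^sup>2 * k * ?c \<le> (d + 1) * (k * (d + 1) * ?c) + ?l * ?c"
      using F_ge by linarith
    also have "\<dots> = ((d + 1)\<^sup>2 * k + ?l) * ?c" by (simp add: power2_eq_square algebra_simps)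
    also have "\<dots> < 4 * (d + 1)\<^sup>2 * k * ?c"
    proof (rule mult_strict_right_mono)
      \<comment> \<open>Both summands are at most \<open>(d + 1)\<^sup>2 * k\<close>, so the factor
        4 leaves room to spare.\<close>
      have "?l < (d + 1) * 1" using less clique_number_bounds(1) by simp
      also have "(d + 1) * 1 \<le> (d + 1)\<^sup>2 * k"
        using k_pos by (intro mult_le_mono) (auto simp: power2_eq_square)
      finally show "(d + 1)\<^sup>2 * k + ?l < 4 * (d + 1)\<^sup>2 * k" by linarith
      show "0 < ?c" using kV k2 by simp
    qed
    finally show False by simp
  qed
  then show ?thesis
    using card_clique_le_clique_number[OF core_subset core_clique] core_subset core_clique
    unfolding maximum_clique_def by simp
qed

section \<open>Edges meeting and missing the core\<close>

lemma core_sets_in_H: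
  assumes "e \<in> nsets V k" "e \<inter> core \<noteq> {}"
  shows "e \<in> H"
proof -
  obtain v where "v \<in> e" "v \<in> core" using assms by blast
  then show ?thesis using cover_in_H[of "{v}" e] assms by (simp add: core_def)
qed

text \<open>An edge missing the core contains a neighbour of every core vertex. A single
  \<open>w\<close> cannot serve them all, or it would enlarge a maximum clique; a core vertex not
  adjacent to \<open>w\<close> supplies the second neighbour.\<close>

lemma two_neighbours_outside_core:
  assumes "f \<in> H" "f \<inter> core = {}"
  obtains P where "P \<in> nsets (closed_nbhd G core - core) 2" "P \<subseteq> f"
proof -
  let ?N = "closed_nbhd G core - core"
  have nb: "\<exists>w\<in>f \<inter> ?N. {v, w} \<in> G" if "v \<in> core" for v
  proof -
    have "closed_nbhd G {v} \<inter> f \<noteq> {}" using that assms(1) by (simp add: core_def nbhd_cover_def)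
    then obtain w where w: "w \<in> f" "w = v \<or> {v, w} \<in> G" by (auto simp: closed_nbhd_def)
    have "w \<notin> core" using w(1) assms(2) by blast
    then have "{v, w} \<in> G" "w \<in> ?N" using w that by (auto simp: closed_nbhd_def)
    then show ?thesis using w(1) by blast
  qed
  obtain v where v: "v \<in> core" using core_nonempty by blast
  then obtain w where w: "w \<in> f" "w \<in> ?N" "{v, w} \<in> G" using nb by blast
  have "\<exists>x\<in>core. {x, w} \<notin> G"
  proof (rule ccontr)
    assume "\<not> ?thesis"
    then have "clique (insert w core) G"
      using core_clique by (auto simp: clique_def insert_commute)
    moreover have "insert w core \<subseteq> V" using w core_subset edgeD by blast
    ultimately have "card (insert w core) \<le> clique_number V G"
      by (intro card_clique_le_clique_number)
    moreover have "finite core" using core_subset finite_V finite_subset by blast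
    ultimately show False using w core_maximum by (simp add: maximum_clique_def)
  qed
  then obtain x where "x \<in> core" "{x, w} \<notin> G" by blast
  then obtain y where y: "y \<in> f" "y \<in> ?N" "y \<noteq> w" using nb by blast
  show ?thesis using w y by (intro that[of "{w, y}"]) (auto simp: nsets_def)
qed

text \<open>Each core vertex spends \<open>card core - 1\<close> of its at most \<open>d\<close>
  neighbours inside the clique.\<close>

lemma card_outer_nbhd_le: "card (closed_nbhd G core - core) \<le> card core * (d + 1 - card core)"
proof -
  have fc: "finite core" using core_subset finite_V finite_subset by blast
  have eq: "closed_nbhd G core - core = (\<Union>v\<in>core. {w. {v, w} \<in> G} - core)"
    unfolding closed_nbhd_def by auto
  have "card (closed_nbhd G core - core) \<le> (\<Sum>v\<in>core. card ({w. {v, w} \<in> G} - core))"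
    unfolding eq by (rule card_UN_le[OF fc])
  also have "\<dots> \<le> (\<Sum>v\<in>core. d + 1 - card core)"
  proof (rule sum_mono)
    fix v assume v: "v \<in> core"
    have "{w. {v, w} \<in> G} - core = {w. {v, w} \<in> G} - (core - {v})"
      using edgeD by blast
    moreover have "core - {v} \<subseteq> {w. {v, w} \<in> G}"
      using core_clique v by (auto simp: clique_def)
    ultimately have "card ({w. {v, w} \<in> G} - core) = card {w. {v, w} \<in> G} - card (core - {v})"
      using fc by (simp add: card_Diff_subset)
    moreover have "card {w. {v, w} \<in> G} \<le> d"
      using degree_le v core_subset unfolding vertex_degree_def by blast
    moreover have "card (core - {v}) = card core - 1" using v fc by simp
    moreover have "1 \<le> card core" using v fc by (metis One_nat_def Suc_leI card_gt_0_iff empty_iff)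
    ultimately show "card ({w. {v, w} \<in> G} - core) \<le> d + 1 - card core" by linarith
  qed
  finally show ?thesis by simp
qed

text \<open>A union bound over the pairs of outer neighbours. Counting inside
  \<open>V - core\<close> gives the upper index \<open>card V - card core - 2\<close>.\<close>

lemma card_missing_core_le:
  assumes "2 \<le> k"
  shows "card {f \<in> H. f \<inter> core = {}}
    \<le> ((card core * (d + 1 - card core)) choose 2) * ((card V - card core - 2) choose (k - 2))"
proof -
  let ?N = "closed_nbhd G core - core"
  have fc: "finite core" using core_subset finite_V finite_subset by blast
  have N: "?N \<subseteq> V - core" using closed_nbhd_subset core_subset by blast
  then have fN: "finite ?N" using finite_V finite_subset by blast
  let ?Q = "\<lambda>P. {f \<in> nsets (V - core) k. P \<subseteq> f}"
  have "{f \<in> H. f \<inter> core = {}} \<subseteq> (\<Union>P\<in>nsets ?N 2. ?Q P)"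
  proof
    fix f assume "f \<in> {f \<in> H. f \<inter> core = {}}"
    then have f: "f \<in> H" "f \<inter> core = {}" by auto
    then have "f \<in> nsets (V - core) k" using H_D by (auto simp: nsets_def)
    then show "f \<in> (\<Union>P\<in>nsets ?N 2. ?Q P)"
      using two_neighbours_outside_core[OF f] by blast
  qed
  then have "card {f \<in> H. f \<inter> core = {}} \<le> card (\<Union>P\<in>nsets ?N 2. ?Q P)"
    using fN finite_V by (intro card_mono) (auto simp: finite_imp_finite_nsets)
  also have "\<dots> \<le> (\<Sum>P\<in>nsets ?N 2. card (?Q P))"
    using fN by (intro card_UN_le finite_imp_finite_nsets)
  also have "\<dots> = (\<Sum>P\<in>nsets ?N 2. (card V - card core - 2) choose (k - 2))"
  proof (rule sum.cong)
    fix P assume P: "P \<in> nsets ?N 2"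
    then have "P \<subseteq> V - core" "card P = 2" using N by (auto simp: nsets_def)
    then show "card (?Q P) = (card V - card core - 2) choose (k - 2)"
      using card_nsets_superset[of "V - core" P k] finite_V assms fc core_subset
      by (simp add: card_Diff_subset)
  qed simp
  also have "\<dots> = (card ?N choose 2) * ((card V - card core - 2) choose (k - 2))" by simp
  also have "\<dots> \<le> ((card core * (d + 1 - card core)) choose 2) * ((card V - card core - 2) choose (k - 2))"
    by (intro mult_le_mono1 binomial_right_mono card_outer_nbhd_le)
  finally show ?thesis .
qed

lemma int_card_H_le:
  defines "w \<equiv> clique_number V G"
  shows "int (card H) \<le> int_binomial (int (card V)) (int k) - int_binomial (int (card V) - int w) (int k)
    + int_binomial (int w * (int d - int w + 1)) 2 * int_binomial (int (card V) - int w - 2) (int k - 2)"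
proof -
  have w: "card core = w" using core_maximum by (simp add: maximum_clique_def w_def)
  have wV: "w \<le> card V" and wd: "w \<le> d + 1" using clique_number_bounds unfolding w_def by auto
  let ?F = "{f \<in> H. f \<inter> core = {}}"
  have "H \<subseteq> {f \<in> nsets V k. f \<inter> core \<noteq> {}} \<union> ?F" using edges_H by auto
  then have "card H \<le> card ({f \<in> nsets V k. f \<inter> core \<noteq> {}} \<union> ?F)"
    using finite_H finite_imp_finite_nsets[OF finite_V] by (intro card_mono) auto
  also have "\<dots> \<le> card {f \<in> nsets V k. f \<inter> core \<noteq> {}} + card ?F" by (rule card_Un_le)
  finally have *: "card H \<le> (card V choose k) - ((card V - w) choose k) + card ?F"
    using card_nsets_meeting[OF finite_V core_subset] w by simp
  have "(card V - w) choose k \<le> card V choose k" by (intro binomial_right_mono) simp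
  then have "int (card H) \<le> int (card V choose k) - int ((card V - w) choose k) + int (card ?F)"
    using * by linarith
  moreover have "int_binomial (int (card V) - int w) (int k) = int ((card V - w) choose k)"
    using int_binomial_of_nat[of "card V - w" k] wV by (simp add: of_nat_diff)
  moreover have "int (card ?F) \<le> int_binomial (int w * (int d - int w + 1)) 2 *
      int_binomial (int (card V) - int w - 2) (int k - 2)"
  \<comment> \<open>With no edge missing the core, nonnegativity of \<open>int_binomial\<close>
    suffices. Otherwise such an edge yields \<open>2 \<le> k\<close> and
    \<open>k \<le> card V - w\<close>, so integer and truncated subtraction agree.\<close>
  proof (cases "?F = {}")
    case True
    then show ?thesis by (simp only: card.empty) (simp add: int_binomial_def)
  next
    case False
    then obtain f P where f: "f \<in> H" "f \<inter> core = {}" and P: "P \<in> nsets (closed_nbhd G core - core) 2" "P \<subseteq> f"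
      using two_neighbours_outside_core by (metis (mono_tags, lifting) Collect_empty_eq)
    have fP: "finite P" "card P = 2" using P by (auto simp: nsets_def)
    have k2: "2 \<le> k" using f P H_D card_mono[of f P] fP by fastforce
    have "f \<subseteq> V - core" using f H_D by blast
    then have "k \<le> card (V - core)" using card_mono[of "V - core" f] finite_V H_D[OF f(1)] by auto
    also have "\<dots> = card V - w"
      using core_subset finite_V finite_subset w by (metis card_Diff_subset)
    finally have kV: "k \<le> card V - w" .
    have a: "int w * (int d - int w + 1) = int (w * (d + 1 - w))" using wd by (simp add: of_nat_diff)
    have b: "int (card V) - int w - 2 = int (card V - w - 2)" "int k - 2 = int (k - 2)"
      using kV k2 by auto
    have c: "int_binomial (int m) 2 = int (m choose 2)" for m
      using int_binomial_of_nat[of m 2] by simp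
    show ?thesis
      using card_missing_core_le[OF k2]
      unfolding a b c int_binomial_of_nat w by (simp only: of_nat_mult[symmetric] of_nat_le_iff)
  qed
  ultimately show ?thesis by (simp add: int_binomial_of_nat)
qed

end

section \<open>Choice of the constant and the case of uniformity zero\<close>

theorem theorem2:
  fixes \<Delta> \<omega> :: nat
  shows "\<exists>C::real. C > 0 \<and>
    (\<forall>(n::nat) (G::nat set set) (k::nat).
       G \<subseteq> nsets {1..n} 2 \<longrightarrow> max_degree {1..n} G = \<Delta> \<longrightarrow> clique_number {1..n} G = \<omega> \<longrightarrow>
       real k < C * sqrt (real n) \<longrightarrow>
       (\<forall>H. H \<subseteq> nsets {1..n} k \<longrightarrow> graph_intersecting G H \<longrightarrow>
          int (card H) \<le> int_binomial (int n) (int k) - int_binomial (int n - int \<omega>) (int k)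
            + int_binomial (int \<omega> * (int \<Delta> - int \<omega> + 1)) 2
              * int_binomial (int n - int \<omega> - 2) (int k - 2)) \<and>
       (\<forall>H. max_graph_intersecting {1..n} G k H \<longrightarrow>
          (\<exists>K. maximum_clique {1..n} G K \<and>
             (\<forall>e \<in> nsets {1..n} k. e \<inter> K \<noteq> {} \<longrightarrow> e \<in> H))))"
proof (intro exI[of _ "1 / (2 * (real \<Delta> + 1))"] conjI allI impI)
  show "1 / (2 * (real \<Delta> + 1)) > 0" by simp
next
  fix n k :: nat and G H :: "nat set set"
  assume G: "G \<subseteq> nsets {1..n} 2" "max_degree {1..n} G = \<Delta>" "clique_number {1..n} G = \<omega>"
    and k: "real k < 1 / (2 * (real \<Delta> + 1)) * sqrt (real n)"
  interpret bounded_degree_graph "{1..n}" G \<Delta>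
    using G by unfold_locales (auto simp: max_degree_def)
  \<comment> \<open>Squaring the hypothesis on \<open>k\<close> turns
    \<open>C = 1 / (2 * (\<Delta> + 1))\<close> into the bound required by
    \<open>max_family\<close>.\<close>
  have small: "4 * (\<Delta> + 1)\<^sup>2 * k * k < card {1..n}"
  proof -
    have "2 * (real \<Delta> + 1) * real k < sqrt (real n)" using k by (simp add: field_simps)
    then have "(2 * (real \<Delta> + 1) * real k)\<^sup>2 < (sqrt (real n))\<^sup>2"
      by (intro power_strict_mono) auto
    then have "real (4 * (\<Delta> + 1)\<^sup>2 * k * k) < real n"
      by (simp add: power2_eq_square algebra_simps)
    then show ?thesis by (simp only: of_nat_less_iff card_atLeastAtMost diff_Suc_1)
  qed
  {
    assume H: "max_graph_intersecting {1..n} G k H"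
    show "\<exists>K. maximum_clique {1..n} G K \<and> (\<forall>e\<in>nsets {1..n} k. e \<inter> K \<noteq> {} \<longrightarrow> e \<in> H)"
    proof (cases "k = 0")
      case True
      then show ?thesis using maximum_clique_exists by auto
    next
      case False
      interpret max_family "{1..n}" G \<Delta> k H
        using H False small by unfold_locales auto
      show ?thesis using core_maximum core_sets_in_H by blast
    qed
  }
  assume H: "H \<subseteq> nsets {1..n} k" "graph_intersecting G H"
  show "int (card H) \<le> int_binomial (int n) (int k) - int_binomial (int n - int \<omega>) (int k)
            + int_binomial (int \<omega> * (int \<Delta> - int \<omega> + 1)) 2
              * int_binomial (int n - int \<omega> - 2) (int k - 2)"
  proof (cases "k = 0")
    case True
    \<comment> \<open>The only candidate edge is empty and does not touch itself. The bound is then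
      \<open>1 - 1 + 0\<close>, using \<open>\<omega> \<le> n\<close> and the zero value at lower
      index \<open>-2\<close>.\<close>
    then have "H = {}" using H by (auto simp: graph_intersecting_def)
    then show ?thesis using True clique_number_bounds(2) G(3) by (simp add: int_binomial_def)
  next
    case False
    obtain H' where H': "max_graph_intersecting {1..n} G k H'"
      using max_graph_intersecting_exists by blast
    interpret max_family "{1..n}" G \<Delta> k H'
      using H' False small by unfold_locales auto
    have "int (card H) \<le> int (card H')" using H_maximum[OF H] by simp
    also note int_card_H_le
    finally show ?thesis using G(3) by simp
  qed
qed

end
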